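(* Let $K$ be a field of characteristic zero and let $\mathfrak{g}$ be a finite-dimensional nilpotent Lie algebra over $K$ with $\dim\mathfrak{g}/[\mathfrak{g},\mathfrak{g}]=2$ and $$z(\mathfrak{g})=\frac{\dim Z(\mathfrak{g})}{\dim\mathfrak{g}}<\frac13.$$ Then $\mathfrak{g}$ does not have property $F$.
   Context: Let $\mathfrak{g}$ be a nilpotent Lie algebra with $\dim\mathfrak{g}/[\mathfrak{g},\mathfrak{g}]=2$. One says that $\mathfrak{g}$ has property $F$ if for every generating pair $(x,y)$ of $\mathfrak{g}$ (i.e. every pair $x,y$ generating $\mathfrak{g}$ as a Lie algebra), all solutions $u,v,w\in[\mathfrak{g},\mathfrak{g}]$ of the two linear equations $$[x,u]+[y,v]=0,\qquad [x,v]+[y,w]=0$$ are contained in the center $Z(\mathfrak{g})$ (that is, $u,v,w\in Z(\mathfrak{g})$ for every such solution). *)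

theory Defs
  imports Complex_Main
begin

locale lie_algebra = vector_space scale
  for scale :: "'k::field \<Rightarrow> 'g::ab_group_add \<Rightarrow> 'g" (infixr \<open>*s\<close> 75) +
  fixes bracket :: "'g \<Rightarrow> 'g \<Rightarrow> 'g"
  assumes linear_left: "Vector_Spaces.linear scale scale (\<lambda>x. bracket x y)"
    and linear_right: "Vector_Spaces.linear scale scale (\<lambda>y. bracket x y)"
    and alternating: "bracket x x = 0"
    and jacobi: "bracket x (bracket y z) + bracket y (bracket z x) + bracket z (bracket x y) = 0"
begin

(* The cosets b + U (b in B) form a basis of the quotient space V / U, where V is the whole type:
   a linear combination of these cosets vanishes in V / U iff the corresponding combination of
   the representatives lies in U, and equals the coset v + U iff the difference lies in U. *)
definition quotient_basis :: "'g set \<Rightarrow> 'g set \<Rightarrow> bool" where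
  "quotient_basis U B \<longleftrightarrow>
     (\<forall>t c. finite t \<and> t \<subseteq> B \<and> (\<Sum>b\<in>t. c b *s b) \<in> U \<longrightarrow> (\<forall>b\<in>t. c b = 0)) \<and>
     (\<forall>v. \<exists>t c. finite t \<and> t \<subseteq> B \<and> v - (\<Sum>b\<in>t. c b *s b) \<in> U)"

(* dim (V / U) for a subspace U, following the pattern of the library's dim *)
definition quotient_dim :: "'g set \<Rightarrow> nat" where
  "quotient_dim U =
     (if \<exists>B. quotient_basis U B then card (SOME B. quotient_basis U B) else 0)"

definition commutator :: "'g set \<Rightarrow> 'g set \<Rightarrow> 'g set" where
  "commutator A B = span {bracket a b | a b. a \<in> A \<and> b \<in> B}"

definition derived :: "'g set" where
  "derived = commutator UNIV UNIV"

primrec lower_central :: "nat \<Rightarrow> 'g set" where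
  "lower_central 0 = UNIV"
| "lower_central (Suc n) = commutator UNIV (lower_central n)"

definition nilpotent :: bool where
  "nilpotent \<longleftrightarrow> (\<exists>n. lower_central n = {0})"

definition center :: "'g set" where
  "center = {z. \<forall>x. bracket x z = 0}"

definition center_ratio :: real where
  "center_ratio = real (dim center) / real (dim UNIV)"

definition subalgebra :: "'g set \<Rightarrow> bool" where
  "subalgebra S \<longleftrightarrow> subspace S \<and> (\<forall>x\<in>S. \<forall>y\<in>S. bracket x y \<in> S)"

definition generating_pair :: "'g \<Rightarrow> 'g \<Rightarrow> bool" where
  "generating_pair x y \<longleftrightarrow> subalgebra hull {x, y} = UNIV"

definition property_F :: bool where
  "property_F \<longleftrightarrow>
     (\<forall>x y. generating_pair x y \<longrightarrow>
       (\<forall>u\<in>derived. \<forall>v\<in>derived. \<forall>w\<in>derived.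
          bracket x u + bracket y v = 0 \<and> bracket x v + bracket y w = 0 \<longrightarrow>
          u \<in> center \<and> v \<in> center \<and> w \<in> center))"

end

end

(* The equations of property F say that (u, v, w) lies in the kernel of a linear map from D^3 to
   C^2, where D = [g,g] and C = [g,D].  With n = dim g, we have dim D >= n - 2, and C is a proper
   subspace of D because g is nilpotent and not abelian.  So the kernel has dimension at least
   3 dim D - 2 (dim D - 1) = dim D + 2 >= n, whereas property F confines it to Z(g)^3,
   of dimension 3 dim Z(g) < n. *)

theory Submission
  imports Defs "HOL-Analysis.Product_Vector"
begin

text \<open>Rank-nullity for \<open>f\<close> restricted to \<open>S\<close>: a linear right inverse
  \<open>g\<close> of \<open>f\<close> on \<open>f\<close>
  S\<open>with values in\<close>S\<open>splits\<close>s\<open>as\<close>(s - g (f s)) + g (f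
  s)\<open>, so\<close>S\<open>is covered by the kernel part and a linear image of\<close>f
  \<open>S\<close>.\<close>

lemma (in finite_dimensional_vector_space_pair) dim_le_dim_kernel_add_dim_image:
  assumes f: "Vector_Spaces.linear s1 s2 f" and S: "vs1.subspace S"
  shows "vs1.dim S \<le> vs1.dim {x \<in> S. f x = 0} + vs2.dim (f ` S)"
proof -
  interpret f: Vector_Spaces.linear s1 s2 f by (fact f)
  let ?K = "{x \<in> S. f x = 0}"
  obtain g where g: "range g \<subseteq> S" "Vector_Spaces.linear s2 s1 g" "\<And>v. v \<in> f ` S \<Longrightarrow> f (g v) = v"
    using linear_exists_right_inverse_on[OF f S] by blast
  interpret g: Vector_Spaces.linear s2 s1 g by (fact g(2))
  interpret rev: finite_dimensional_vector_space_pair s2 B2 s1 B1 by unfold_locales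
  let ?T = "g ` f ` S"
  have K: "vs1.subspace ?K"
    using vs1.subspace_inter[OF S f.subspace_kernel] by (simp add: Int_def)
  have T: "vs1.subspace ?T"
    by (intro g.subspace_image f.subspace_image S)
  have "S \<subseteq> {a + b |a b. a \<in> ?K \<and> b \<in> ?T}"
  proof
    fix s assume s: "s \<in> S"
    have "s - g (f s) \<in> ?K"
      using s g(1,3) by (auto simp: f.diff intro!: vs1.subspace_diff[OF S])
    moreover have "s = (s - g (f s)) + g (f s)" by simp
    ultimately show "s \<in> {a + b |a b. a \<in> ?K \<and> b \<in> ?T}" using s by blast
  qed
  then have "vs1.dim S \<le> vs1.dim {a + b |a b. a \<in> ?K \<and> b \<in> ?T}"
    by (rule vs1.dim_subset)
  also have "\<dots> \<le> vs1.dim ?K + vs1.dim ?T"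
    using vs1.dim_sums_Int[OF K T] by simp
  also have "vs1.dim ?T \<le> vs2.dim (f ` S)"
    by (rule rev.dim_image_le[OF g(2)])
  finally show ?thesis by simp
qed

context lie_algebra
begin

lemma bracket_add_left: "bracket (x + y) z = bracket x z + bracket y z"
  using linear_left by (simp add: Vector_Spaces.linear_iff)

lemma bracket_add_right: "bracket x (y + z) = bracket x y + bracket x z"
  using linear_right by (simp add: Vector_Spaces.linear_iff)

lemma bracket_scale_right: "bracket x (c *s y) = c *s bracket x y"
  using linear_right by (simp add: Vector_Spaces.linear_iff)

lemma bracket_zero_right: "bracket x 0 = 0"
  using bracket_scale_right[of x 0 0] by simp

lemma bracket_swap: "bracket x y = - bracket y x"
proof -
  have "0 = bracket (x + y) (x + y)" by (simp only: alternating)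
  also have "\<dots> = bracket x y + bracket y x"
    by (simp only: bracket_add_left bracket_add_right) (simp add: alternating)
  finally show ?thesis by (metis eq_neg_iff_add_eq_0)
qed

lemma bracket_in_commutator: "a \<in> A \<Longrightarrow> b \<in> B \<Longrightarrow> bracket a b \<in> commutator A B"
  unfolding commutator_def by (rule span_base) blast

lemma commutator_mono: "A \<subseteq> A' \<Longrightarrow> B \<subseteq> B' \<Longrightarrow> commutator A B \<subseteq> commutator A' B'"
  unfolding commutator_def by (rule span_mono) blast

lemma subspace_commutator: "subspace (commutator A B)"
  by (simp add: commutator_def)

lemma subspace_derived: "subspace derived"
  by (simp add: derived_def subspace_commutator)

lemma lower_central_Suc_0: "lower_central (Suc 0) = derived"
  by (simp add: derived_def)

lemma center_eq_UNIV_if_derived_trivial: "derived = {0} \<Longrightarrow> center = UNIV"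
  using bracket_in_commutator[of _ UNIV _ UNIV] by (auto simp: center_def derived_def)

text \<open>The lower central series would be constant from index 1 on, so its reaching
  \<open>{0}\<close> forces \<open>derived\<close> to vanish. In the nonabelian case this makes
  [g,[g,g]] a proper subspace of [g,g].\<close>

lemma derived_trivial_if_commutator_eq:
  assumes "nilpotent" and eq: "commutator UNIV derived = derived"
  shows "derived = {0}"
proof -
  have const: "lower_central (Suc n) = derived" for n
    by (induction n) (simp_all add: derived_def[symmetric] eq)
  obtain n where n: "lower_central n = {0}" using assms(1) by (auto simp: nilpotent_def)
  show ?thesis
  proof (cases n)
    case 0
    then have "derived \<subseteq> {0}" using n by auto
    then show ?thesis using subspace_0[OF subspace_derived] by blast
  next
    case (Suc m)
    then show ?thesis using n const by simp
  qed
qed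

text \<open>By induction, \<open>S\<close> together with any later term of the lower central series
  spans everything, and nilpotency makes that term vanish. This is why lifts of a basis of g/[g,g]
  generate g.\<close>

lemma subalgebra_spanning_modulo_derived_eq_UNIV:
  assumes nil: "nilpotent" and S: "subalgebra S"
    and span: "\<And>g. \<exists>s\<in>S. g - s \<in> derived"
  shows "S = UNIV"
proof -
  have sub: "subspace S" using S by (simp add: subalgebra_def)
  have *: "\<exists>s\<in>S. g - s \<in> lower_central (Suc n)" for n g
  proof (induction n arbitrary: g)
    case 0
    then show ?case using span by (simp only: lower_central_Suc_0)
  next
    case (Suc n)
    let ?L = "lower_central (Suc (Suc n))"
    have L: "subspace ?L" by (simp add: subspace_commutator)
    let ?M = "{s + l |s l. s \<in> S \<and> l \<in> ?L}"
    have M: "subspace ?M" by (rule subspace_sums[OF sub L])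
    \<comment> \<open>With a = s + a' and b = t + b', where a' and b' lie in
      \<open>lower_central (Suc n)\<close>, one has [a,b] = [s,t] + [s,b'] - [b,a']. The swap in the
      last term puts a' into the right slot, as \<open>lower_central\<close> requires.\<close>
    have "bracket a b \<in> ?M" for a b
    proof -
      obtain s where s: "s \<in> S" "a - s \<in> lower_central (Suc n)" using Suc by blast
      obtain t where t: "t \<in> S" "b - t \<in> lower_central (Suc n)" using Suc by blast
      have "bracket a b = bracket s t + (bracket s (b - t) - bracket b (a - s))"
        using bracket_add_left[of s "a - s" b] bracket_add_right[of s t "b - t"]
          bracket_swap[of b "a - s"] by simp
      moreover have "bracket s t \<in> S" using S s t by (simp add: subalgebra_def)
      moreover have "bracket s (b - t) - bracket b (a - s) \<in> ?L"
        using s t by (intro subspace_diff[OF L]) (simp_all add: bracket_in_commutator)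
      ultimately show ?thesis by blast
    qed
    then have D: "derived \<subseteq> ?M"
      unfolding derived_def commutator_def by (intro span_minimal M) blast
    obtain s where s: "s \<in> S" "g - s \<in> derived" using span by blast
    then obtain t l where "t \<in> S" "l \<in> ?L" "g - s = t + l" using D by blast
    then have "s + t \<in> S" "g - (s + t) \<in> ?L"
      using s sub by (auto simp: subspace_add algebra_simps)
    then show ?case by blast
  qed
  obtain n where "lower_central n = {0}" using nil by (auto simp: nilpotent_def)
  \<comment> \<open>The induction starts at index 1, so the vanishing is moved one index up; this
    also covers n = 0.\<close>
  then have "lower_central (Suc n) = {0}"
    by (simp add: commutator_def bracket_zero_right)
  then show ?thesis using *[of _ n] by (auto simp: set_eq_iff)
qed

end

locale finite_dimensional_lie_algebra =
  lie_algebra scale bracket + finite_dimensional_vector_space scale Basis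
  for scale :: "'k::field \<Rightarrow> 'g::ab_group_add \<Rightarrow> 'g" (infixr \<open>*s\<close> 75)
    and bracket :: "'g \<Rightarrow> 'g \<Rightarrow> 'g"
    and Basis :: "'g set"
begin

lemma dim_derived_bound_if_property_F:
  assumes F: "property_F" and gen: "generating_pair x y"
  shows "3 * dim derived \<le> 3 * dim center + 2 * dim (commutator UNIV derived)"
proof -
  let ?D = derived and ?C = "commutator UNIV derived"
  \<comment> \<open>Triples are nested pairs: \<open>P3\<close> is the domain of \<open>f\<close>,
    while \<open>P2\<close> is both the second factor of \<open>P3\<close> and the codomain.\<close>
  interpret P2: finite_dimensional_vector_space_prod scale scale Basis Basis
    by unfold_locales
  interpret P3: finite_dimensional_vector_space_prod scale P2.scale Basis P2.Basis_pair
    by unfold_locales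
  interpret lin: finite_dimensional_vector_space_pair P3.scale P3.Basis_pair P2.scale P2.Basis_pair
    by unfold_locales
  define f where
    "f = (\<lambda>(u, v, w). (bracket x u + bracket y v, bracket x v + bracket y w))"
  have f: "Vector_Spaces.linear P3.scale P2.scale f"
    unfolding f_def Vector_Spaces.linear_iff
    by (auto simp: P2.scale_def P3.scale_def bracket_add_right bracket_scale_right
        scale_right_distrib P2.p.vector_space_axioms P3.p.vector_space_axioms algebra_simps)
  have center: "subspace center"
    by (rule subspaceI) (auto simp: center_def bracket_add_right bracket_scale_right
        bracket_zero_right)
  have C: "subspace ?C" by (rule subspace_commutator)
  have D3: "P3.p.subspace (?D \<times> ?D \<times> ?D)"
    by (intro P3.subspace_Times P2.subspace_Times subspace_derived)
  have "f ` (?D \<times> ?D \<times> ?D) \<subseteq> ?C \<times> ?C"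
    by (auto simp: f_def intro!: subspace_add[OF C] bracket_in_commutator)
  from P2.p.dim_subset[OF this]
  have image: "P2.p.dim (f ` (?D \<times> ?D \<times> ?D)) \<le> 2 * dim ?C"
    by (simp add: P2.dim_Times[OF C C])
  have "{p \<in> ?D \<times> ?D \<times> ?D. f p = 0} \<subseteq> center \<times> center \<times> center"
  proof
    fix p assume p: "p \<in> {p \<in> ?D \<times> ?D \<times> ?D. f p = 0}"
    obtain u v w where uvw: "p = (u, v, w)" by (cases p)
    with p have "u \<in> ?D" "v \<in> ?D" "w \<in> ?D" "f (u, v, w) = 0" by simp_all
    with F gen show "p \<in> center \<times> center \<times> center"
      by (simp add: f_def property_F_def zero_prod_def uvw)
  qed
  from P3.p.dim_subset[OF this]
  have kernel: "P3.p.dim {p \<in> ?D \<times> ?D \<times> ?D. f p = 0} \<le> 3 * dim center"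
    by (simp add: P3.dim_Times[OF center P2.subspace_Times[OF center center]]
        P2.dim_Times[OF center center])
  have "3 * dim ?D = P3.p.dim (?D \<times> ?D \<times> ?D)"
    by (simp add: P3.dim_Times P2.dim_Times P2.subspace_Times subspace_derived)
  also have "\<dots> \<le> P3.p.dim {p \<in> ?D \<times> ?D \<times> ?D. f p = 0} + P2.p.dim (f ` (?D \<times> ?D \<times> ?D))"
    by (rule lin.dim_le_dim_kernel_add_dim_image[OF f D3])
  finally show ?thesis using kernel image by simp
qed

text \<open>The abelian case is separate because [g,[g,g]] is a proper subspace of [g,g] only if
  [g,g] is nonzero; there the center is everything.\<close>

lemma dim_UNIV_le_dim_center_if_property_F:
  assumes F: "property_F" and nil: "nilpotent" and q: "quotient_dim derived = 2"
  shows "dim UNIV \<le> 3 * dim center"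
proof (cases "derived = {0}")
  case True
  then show ?thesis using center_eq_UNIV_if_derived_trivial by simp
next
  case False
  let ?D = derived and ?C = "commutator UNIV derived"
  \<comment> \<open>\<open>quotient_dim\<close> defaults to 0 when there is no quotient basis, so
    the value 2 guarantees that the chosen set is one.\<close>
  obtain B where B: "quotient_basis ?D B" "card B = 2"
    using q someI_ex[of "quotient_basis ?D"] by (auto simp: quotient_dim_def split: if_splits)
  obtain x y where xy: "B = {x, y}"
    using B(2) by (auto simp: card_2_iff)
  have mod_D: "\<exists>s\<in>span {x, y}. g - s \<in> ?D" for g
  proof -
    from B(1) have "\<exists>t c. finite t \<and> t \<subseteq> B \<and> g - (\<Sum>b\<in>t. c b *s b) \<in> ?D"
      by (simp add: quotient_basis_def)
    then obtain t c where tc: "t \<subseteq> B" "g - (\<Sum>b\<in>t. c b *s b) \<in> ?D"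
      by auto
    then have "(\<Sum>b\<in>t. c b *s b) \<in> span {x, y}"
      by (intro span_sum span_scale span_base) (auto simp: xy)
    with tc(2) show ?thesis by blast
  qed
  have gen: "generating_pair x y"
    unfolding generating_pair_def
  proof (rule subalgebra_spanning_modulo_derived_eq_UNIV[OF nil])
    show sub: "subalgebra (subalgebra hull {x, y})"
      by (rule hull_in) (auto simp: subalgebra_def intro!: subspace_Inter)
    have "span {x, y} \<subseteq> subalgebra hull {x, y}"
      using sub by (intro span_minimal hull_subset) (simp add: subalgebra_def)
    then show "\<exists>s\<in>subalgebra hull {x, y}. g - s \<in> ?D" for g
      using mod_D by blast
  qed
  have "g \<in> span (insert x (insert y ?D))" for g
  proof -
    obtain s where s: "s \<in> span {x, y}" "g - s \<in> ?D" using mod_D by blast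
    have "s + (g - s) \<in> span (insert x (insert y ?D))"
      using s span_mono[of "{x, y}" "insert x (insert y ?D)"]
      by (intro span_add) (auto intro: span_base)
    then show ?thesis by simp
  qed
  then have "dim UNIV \<le> dim (insert x (insert y ?D))"
    by (intro dim_mono) blast
  also have "\<dots> \<le> dim ?D + 2"
    by (simp add: dim_insert)
  finally have le: "dim UNIV \<le> dim ?D + 2" .
  have "?C \<subset> ?D"
    using False derived_trivial_if_commutator_eq[OF nil] commutator_mono[of UNIV UNIV ?D UNIV]
    by (auto simp: derived_def)
  then have "dim ?C < dim ?D"
    by (intro dim_psubset) (simp add: span_eq_iff[THEN iffD2] subspace_commutator subspace_derived)
  \<comment> \<open>With d = \<open>dim derived\<close> and z = \<open>dim center\<close>: 3d \<le>
    3z + 2(d - 1) gives d + 2 \<le> 3z.\<close>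
  then show ?thesis
    using dim_derived_bound_if_property_F[OF F gen] le by linarith
qed

text \<open>In the zero space every set, hence every quotient basis, has at most one
  element.\<close>

lemma dim_UNIV_pos_if_quotient_dim_gt_1:
  assumes "quotient_dim U > 1"
  shows "dim UNIV > 0"
proof (rule ccontr)
  assume "\<not> ?thesis"
  then have "(UNIV :: 'g set) \<subseteq> {0}" using dim_eq_0[of UNIV] by blast
  then have "card A \<le> 1" for A :: "'g set"
    using card_mono[of "{0}" A] by fastforce
  then show False using assms by (auto simp: quotient_dim_def not_less[symmetric] split: if_splits)
qed

end

theorem lemma5p3:
  fixes scale :: "'k::field_char_0 \<Rightarrow> 'g::ab_group_add \<Rightarrow> 'g"
    and bracket :: "'g \<Rightarrow> 'g \<Rightarrow> 'g"
    and Basis :: "'g set"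
  assumes "lie_algebra scale bracket"
    and "finite_dimensional_vector_space scale Basis"
    and "lie_algebra.nilpotent scale bracket"
    and "lie_algebra.quotient_dim scale (lie_algebra.derived scale bracket) = 2"
    and "lie_algebra.center_ratio scale bracket < 1 / 3"
  shows "\<not> lie_algebra.property_F scale bracket"
proof
  assume F: "lie_algebra.property_F scale bracket"
  interpret finite_dimensional_lie_algebra scale bracket Basis
    using assms(1,2) by (simp add: finite_dimensional_lie_algebra_def)
  \<comment> \<open>Division by zero yields 0, so \<open>center_ratio\<close> is below 1/3 for the
    zero algebra as well; positivity allows the denominator to be cleared.\<close>
  have "dim UNIV > 0"
    by (rule dim_UNIV_pos_if_quotient_dim_gt_1[of derived]) (simp add: assms(4))
  moreover have "dim UNIV \<le> 3 * dim center"
    using dim_UNIV_le_dim_center_if_property_F F assms(3,4) by blast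
  ultimately show False
    using assms(5) by (simp add: center_ratio_def field_simps del: dim_UNIV)
qed

end
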